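(* A CR-submanifold $(M^{d+l},g)$ in $\mathbb{C}^q$ with $\mathrm{S}_{\mathrm{m}}(D,D^\perp)>0$ cannot be $D$-minimal, where $D=\bar J(TM)\cap TM$ and $D^\perp$ is the orthogonal complement of $D$ in $TM$.
   Context: $\mathbb{C}^q$ carries its standard flat Hermitian structure, with complex structure $\bar J$. A submanifold $M^{d+l}$ ($d,l>0$) of $\mathbb{C}^q$ with the induced metric $g$ is a CR-submanifold if $D=\bar J(TM)\cap TM$ (the maximal $\bar J$-invariant subbundle of $TM$) is a distribution of constant real dimension $d$. The mutual curvature of $(D,D^\perp)$ is the function $\mathrm{S}_{\mathrm{m}}(D,D^\perp)(x)=\sum_{1\le a\le d,\ d<b\le d+l}K(e_a,e_b)$ on $M$, where $K$ is the sectional curvature of $(M,g)$ and $\{e_i\}$ is an orthonormal basis of $T_xM$ with $e_1,\ldots,e_d\in D(x)$ and $e_{d+1},\ldots,e_{d+l}\in D^\perp(x)$. With $h$ the second fundamental form of $M$ and $\{e_i\}$ an orthonormal basis of $D_x$, put $H_{D_x}=\sum_{i=1}^d h(e_i,e_i)$; $M$ is $D$-minimal if $H_D\equiv0$. *)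

theory Defs
  imports "HOL-Analysis.Analysis"
begin

section \<open>Smooth maps\<close>

primrec Ck_on :: "nat \<Rightarrow> 'a::real_normed_vector set \<Rightarrow> ('a \<Rightarrow> 'b::real_normed_vector) \<Rightarrow> bool" where
  "Ck_on 0 U F \<longleftrightarrow> continuous_on U F"
| "Ck_on (Suc k) U F \<longleftrightarrow> (\<forall>x\<in>U. F differentiable (at x)) \<and>
     (\<forall>v. Ck_on k U (\<lambda>x. frechet_derivative F (at x) v))"

text \<open>Only meant for open \<open>U\<close>.\<close>

definition smooth_on :: "'a::real_normed_vector set \<Rightarrow> ('a \<Rightarrow> 'b::real_normed_vector) \<Rightarrow> bool" where
  "smooth_on U F \<longleftrightarrow> (\<forall>k. Ck_on k U F)"

definition partial :: "'n \<Rightarrow> (real^'n \<Rightarrow> 'b::real_normed_vector) \<Rightarrow> real^'n \<Rightarrow> 'b" where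
  "partial i F x = frechet_derivative F (at x) (axis i 1)"

section \<open>Curvature of a Riemannian metric on a domain of \<open>\<real>\<^sup>n\<close>\<close>

text \<open>The metric is given by its coefficient matrix \<open>g x $ i $ j\<close>.  Christoffel symbols of the
  Levi-Civita connection: \<open>\<nabla>\<^sub>i \<partial>\<^sub>j = (\<Sum>k. christoffel g k i j \<partial>\<^sub>k)\<close>.\<close>

definition christoffel ::
    "(real^'n \<Rightarrow> real^'n^'n) \<Rightarrow> 'n \<Rightarrow> 'n \<Rightarrow> 'n \<Rightarrow> real^'n \<Rightarrow> real" where
  "christoffel g k i j x = (\<Sum>m\<in>UNIV. matrix_inv (g x) $ k $ m *
     (partial i (\<lambda>y. g y $ j $ m) x + partial j (\<lambda>y. g y $ i $ m) x
       - partial m (\<lambda>y. g y $ i $ j) x)) / 2"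

text \<open>Sign convention: \<open>R(X,Y)Z = \<nabla>\<^sub>X \<nabla>\<^sub>Y Z - \<nabla>\<^sub>Y \<nabla>\<^sub>X Z - \<nabla>\<^sub>[\<^sub>X\<^sub>,\<^sub>Y\<^sub>] Z\<close>; \<open>riemann_coeff g m i j k\<close> is the
  \<open>\<partial>\<^sub>m\<close>-component of \<open>R(\<partial>\<^sub>i,\<partial>\<^sub>j)\<partial>\<^sub>k\<close>.\<close>

definition riemann_coeff ::
    "(real^'n \<Rightarrow> real^'n^'n) \<Rightarrow> 'n \<Rightarrow> 'n \<Rightarrow> 'n \<Rightarrow> 'n \<Rightarrow> real^'n \<Rightarrow> real" where
  "riemann_coeff g m i j k x =
     partial i (christoffel g m j k) x - partial j (christoffel g m i k) x
     + (\<Sum>s\<in>UNIV. christoffel g s j k x * christoffel g m i s x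
                   - christoffel g s i k x * christoffel g m j s x)"

definition riemann ::
    "(real^'n \<Rightarrow> real^'n^'n) \<Rightarrow> real^'n \<Rightarrow> real^'n \<Rightarrow> real^'n \<Rightarrow> real^'n \<Rightarrow> real^'n" where
  "riemann g x X Y Z =
     (\<chi> m. \<Sum>i\<in>UNIV. \<Sum>j\<in>UNIV. \<Sum>k\<in>UNIV. X $ i * Y $ j * Z $ k * riemann_coeff g m i j k x)"

definition metric_inner :: "(real^'n \<Rightarrow> real^'n^'n) \<Rightarrow> real^'n \<Rightarrow> real^'n \<Rightarrow> real^'n \<Rightarrow> real" where
  "metric_inner g x X Y = X \<bullet> (g x *v Y)"

definition sectional_curvature_coord ::
    "(real^'n \<Rightarrow> real^'n^'n) \<Rightarrow> real^'n \<Rightarrow> real^'n \<Rightarrow> real^'n \<Rightarrow> real" where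
  "sectional_curvature_coord g x X Y =
     metric_inner g x (riemann g x X Y Y) X /
     (metric_inner g x X X * metric_inner g x Y Y - (metric_inner g x X Y)\<^sup>2)"

section \<open>Submanifolds\<close>

text \<open>An element \<open>(U, \<psi>)\<close> of the atlas is an inverse chart: \<open>\<psi>\<close> maps the open set \<open>U\<close> of
  \<open>\<real>\<^sup>n\<close> homeomorphically onto an open set of the manifold.\<close>

definition smooth_manifold :: "'m topology \<Rightarrow> ((real^'n) set \<times> (real^'n \<Rightarrow> 'm)) set \<Rightarrow> bool" where
  "smooth_manifold M A \<longleftrightarrow>
     Hausdorff_space M \<and> second_countable M \<and>
     (\<forall>(U, \<psi>)\<in>A. open U \<and> openin M (\<psi> ` U) \<and>
        homeomorphic_map (top_of_set U) (subtopology M (\<psi> ` U)) \<psi>) \<and>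
     (\<Union>(U, \<psi>)\<in>A. \<psi> ` U) = topspace M \<and>
     (\<forall>(U, \<psi>)\<in>A. \<forall>(V, \<eta>)\<in>A. smooth_on (U \<inter> \<psi> -` (\<eta> ` V)) (inv_into V \<eta> \<circ> \<psi>))"

definition smooth_immersion ::
    "((real^'n) set \<times> (real^'n \<Rightarrow> 'm)) set \<Rightarrow> ('m \<Rightarrow> 'b::euclidean_space) \<Rightarrow> bool" where
  "smooth_immersion A f \<longleftrightarrow>
     (\<forall>(U, \<psi>)\<in>A. smooth_on U (f \<circ> \<psi>) \<and>
        (\<forall>y\<in>U. inj (frechet_derivative (f \<circ> \<psi>) (at y))))"

text \<open>A submanifold is a smooth manifold with a smooth immersion \<open>f\<close> into Euclidean space;
  embedded submanifolds are the case where \<open>f\<close> is the inclusion of a subset with the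
  subspace topology.\<close>

definition immersed_submanifold ::
    "'m topology \<Rightarrow> ((real^'n) set \<times> (real^'n \<Rightarrow> 'm)) set \<Rightarrow> ('m \<Rightarrow> 'b::euclidean_space) \<Rightarrow> bool" where
  "immersed_submanifold M A f \<longleftrightarrow> smooth_manifold M A \<and> smooth_immersion A f"

text \<open>The tensors below are computed in some chart around the point and, where a trace is taken,
  in some orthonormal basis; the results do not depend on these choices.\<close>

definition chart_at ::
    "((real^'n) set \<times> (real^'n \<Rightarrow> 'm)) set \<Rightarrow> 'm \<Rightarrow> (real^'n) set \<times> (real^'n \<Rightarrow> 'm)" where
  "chart_at A p = (SOME c. c \<in> A \<and> p \<in> snd c ` fst c)"

definition coord_at :: "((real^'n) set \<times> (real^'n \<Rightarrow> 'm)) set \<Rightarrow> 'm \<Rightarrow> real^'n" where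
  "coord_at A p = inv_into (fst (chart_at A p)) (snd (chart_at A p)) p"

definition local_rep ::
    "((real^'n) set \<times> (real^'n \<Rightarrow> 'm)) set \<Rightarrow> ('m \<Rightarrow> 'b) \<Rightarrow> 'm \<Rightarrow> real^'n \<Rightarrow> 'b" where
  "local_rep A f p = f \<circ> snd (chart_at A p)"

definition differential ::
    "((real^'n) set \<times> (real^'n \<Rightarrow> 'm)) set \<Rightarrow> ('m \<Rightarrow> 'b::euclidean_space) \<Rightarrow> 'm \<Rightarrow> real^'n \<Rightarrow> 'b" where
  "differential A f p = frechet_derivative (local_rep A f p) (at (coord_at A p))"

text \<open>Tangent vectors are identified with their images under the differential of the immersion;
  \<open>tangent_coords\<close> recovers their coordinates in the chart.\<close>

definition tangent_space ::
    "((real^'n) set \<times> (real^'n \<Rightarrow> 'm)) set \<Rightarrow> ('m \<Rightarrow> 'b::euclidean_space) \<Rightarrow> 'm \<Rightarrow> 'b set" where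
  "tangent_space A f p = range (differential A f p)"

definition tangent_coords ::
    "((real^'n) set \<times> (real^'n \<Rightarrow> 'm)) set \<Rightarrow> ('m \<Rightarrow> 'b::euclidean_space) \<Rightarrow> 'm \<Rightarrow> 'b \<Rightarrow> real^'n" where
  "tangent_coords A f p = inv (differential A f p)"

definition induced_metric :: "(real^'n \<Rightarrow> 'b::euclidean_space) \<Rightarrow> real^'n \<Rightarrow> real^'n^'n" where
  "induced_metric \<phi> x = (\<chi> i j. partial i \<phi> x \<bullet> partial j \<phi> x)"

definition sectional_curvature ::
    "((real^'n) set \<times> (real^'n \<Rightarrow> 'm)) set \<Rightarrow> ('m \<Rightarrow> 'b::euclidean_space) \<Rightarrow> 'm \<Rightarrow> 'b \<Rightarrow> 'b \<Rightarrow> real" where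
  "sectional_curvature A f p u v =
     sectional_curvature_coord (induced_metric (local_rep A f p)) (coord_at A p)
       (tangent_coords A f p u) (tangent_coords A f p v)"

definition normal_component :: "'b::euclidean_space set \<Rightarrow> 'b \<Rightarrow> 'b" where
  "normal_component T w = (THE n. n \<in> T\<^sup>\<bottom> \<and> w - n \<in> T)"

text \<open>The normal component of the flat derivative, in direction \<open>u\<close>, of a tangent field extending
  \<open>v\<close>; the extension used is the field with constant coordinates in the chart.\<close>

definition second_fundamental_form ::
    "((real^'n) set \<times> (real^'n \<Rightarrow> 'm)) set \<Rightarrow> ('m \<Rightarrow> 'b::euclidean_space) \<Rightarrow> 'm \<Rightarrow> 'b \<Rightarrow> 'b \<Rightarrow> 'b" where
  "second_fundamental_form A f p u v =
     (let V = (\<lambda>y. frechet_derivative (local_rep A f p) (at y) (tangent_coords A f p v))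
      in normal_component (tangent_space A f p)
           (frechet_derivative V (at (coord_at A p)) (tangent_coords A f p u)))"

section \<open>Distributions\<close>

definition orthonormal_basis_of :: "'b::euclidean_space set \<Rightarrow> 'b set \<Rightarrow> bool" where
  "orthonormal_basis_of S B \<longleftrightarrow>
     pairwise orthogonal B \<and> (\<forall>b\<in>B. norm b = 1) \<and> span B = S"

definition some_orthonormal_basis :: "'b::euclidean_space set \<Rightarrow> 'b set" where
  "some_orthonormal_basis S = (SOME B. orthonormal_basis_of S B)"

definition mutual_curvature ::
    "((real^'n) set \<times> (real^'n \<Rightarrow> 'm)) set \<Rightarrow> ('m \<Rightarrow> 'b::euclidean_space) \<Rightarrow>
     ('m \<Rightarrow> 'b set) \<Rightarrow> ('m \<Rightarrow> 'b set) \<Rightarrow> 'm \<Rightarrow> real" where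
  "mutual_curvature A f P Q p =
     (\<Sum>u\<in>some_orthonormal_basis (P p). \<Sum>v\<in>some_orthonormal_basis (Q p).
        sectional_curvature A f p u v)"

definition mean_curvature_vector ::
    "((real^'n) set \<times> (real^'n \<Rightarrow> 'm)) set \<Rightarrow> ('m \<Rightarrow> 'b::euclidean_space) \<Rightarrow>
     ('m \<Rightarrow> 'b set) \<Rightarrow> 'm \<Rightarrow> 'b" where
  "mean_curvature_vector A f P p =
     (\<Sum>u\<in>some_orthonormal_basis (P p). second_fundamental_form A f p u u)"

definition distribution_minimal ::
    "'m topology \<Rightarrow> ((real^'n) set \<times> (real^'n \<Rightarrow> 'm)) set \<Rightarrow> ('m \<Rightarrow> 'b::euclidean_space) \<Rightarrow>
     ('m \<Rightarrow> 'b set) \<Rightarrow> bool" where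
  "distribution_minimal M A f P \<longleftrightarrow> (\<forall>p\<in>topspace M. mean_curvature_vector A f P p = 0)"

section \<open>CR-submanifolds of \<open>\<complex>\<^sup>q\<close>\<close>

text \<open>The inner product of \<^typ>\<open>complex^'q\<close> is the real part of the standard Hermitian form, and
  \<^const>\<open>dim\<close> and \<^const>\<open>span\<close> are taken over the reals.\<close>

definition complex_structure :: "complex^'q \<Rightarrow> complex^'q" where
  "complex_structure v = \<i> *s v"

definition holomorphic_distribution ::
    "((real^'n) set \<times> (real^'n \<Rightarrow> 'm)) set \<Rightarrow> ('m \<Rightarrow> complex^'q) \<Rightarrow> 'm \<Rightarrow> (complex^'q) set" where
  "holomorphic_distribution A f p =
     complex_structure ` tangent_space A f p \<inter> tangent_space A f p"

definition tangent_complement ::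
    "((real^'n) set \<times> (real^'n \<Rightarrow> 'm)) set \<Rightarrow> ('m \<Rightarrow> 'b::euclidean_space) \<Rightarrow>
     ('m \<Rightarrow> 'b set) \<Rightarrow> 'm \<Rightarrow> 'b set" where
  "tangent_complement A f P p = (P p)\<^sup>\<bottom> \<inter> tangent_space A f p"

text \<open>Smoothness of the distribution is automatic once the rank is constant: it is the kernel of
  the bundle map taking a tangent vector \<open>v\<close> to the normal component of \<open>complex_structure v\<close>.\<close>

definition CR_submanifold ::
    "'m topology \<Rightarrow> ((real^'n) set \<times> (real^'n \<Rightarrow> 'm)) set \<Rightarrow> ('m \<Rightarrow> complex^'q) \<Rightarrow>
     nat \<Rightarrow> nat \<Rightarrow> bool" where
  "CR_submanifold M A f d l \<longleftrightarrow>
     immersed_submanifold M A f \<and> CARD('n) = d + l \<and>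
     (\<forall>p\<in>topspace M. dim (holomorphic_distribution A f p) = d)"

end

theory Submission
  imports Defs
begin

text \<open>Summing the Gauss equation \<open>K(u, v) = \<langle>h(u,u), h(v,v)\<rangle> - |h(u,v)|\<^sup>2\<close> over orthonormal bases of two
  orthogonal distributions \<open>P\<close> and \<open>Q\<close> gives
  \<open>S\<^sub>m(P, Q) = \<langle>H\<^sub>P, H\<^sub>Q\<rangle> - \<Sum> |h(u,v)|\<^sup>2\<close>, which is nonpositive as soon as \<open>H\<^sub>P = 0\<close>.
  The Gauss equation itself is obtained in a chart by splitting the second partial derivatives of
  the immersion into the part given by the Christoffel symbols, which is tangential, and a normal
  rest, and by differentiating the orthogonality of that rest to the tangent vectors.\<close>

subsection \<open>Smooth maps\<close>

text \<open>The second difference is symmetric in \<open>u\<close> and \<open>v\<close>; this is what makes mixed second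
  derivatives commute.\<close>

lemma second_difference_approx:
  fixes F :: "'a::real_normed_vector \<Rightarrow> real"
  assumes U: "open U" "x \<in> U"
    and F: "\<And>y. y \<in> U \<Longrightarrow> (F has_derivative F' y) (at y)"
    and G: "\<And>y. y \<in> U \<Longrightarrow> ((\<lambda>z. F' z u) has_derivative G y) (at y)"
    and cont: "continuous_on U (\<lambda>y. G y v)" and "e > 0"
  shows "\<forall>\<^sub>F t in at_right 0.
    \<bar>F (x + t *\<^sub>R u + t *\<^sub>R v) - F (x + t *\<^sub>R u) - F (x + t *\<^sub>R v) + F x - t\<^sup>2 * G x v\<bar> \<le> e * t\<^sup>2"
proof -
  have "isCont (\<lambda>y. G y v) x"
    using cont U continuous_on_eq_continuous_at by blast
  then obtain r1 where r1: "r1 > 0" "\<And>y. dist y x < r1 \<Longrightarrow> dist (G y v) (G x v) < e"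
    using \<open>e > 0\<close> unfolding continuous_at_eps_delta dist_norm by blast
  obtain r2 where r2: "r2 > 0" "ball x r2 \<subseteq> U"
    using U openE by blast
  define r where "r = min r1 r2"
  \<comment> \<open>The summand \<open>1\<close> keeps \<open>N\<close> positive even for
    \<open>u = v = 0\<close>. For \<open>0 < t < r / N\<close> the whole parallelogram with sides
    \<open>t *\<^sub>R u\<close> and \<open>t *\<^sub>R v\<close> at \<open>x\<close> then lies
    within distance \<open>r\<close> of \<open>x\<close>.\<close>
  define N where "N = norm u + norm v + 1"
  have "r > 0" "N > 0" using r1 r2 by (auto simp: r_def N_def add_nonneg_pos)
  have near: "x + s *\<^sub>R u + w *\<^sub>R v \<in> U" "\<bar>G (x + s *\<^sub>R u + w *\<^sub>R v) v - G x v\<bar> < e"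
    if "0 \<le> s" "s \<le> t" "0 \<le> w" "w \<le> t" "t < r / N" for s w t
  proof -
    have "norm (s *\<^sub>R u + w *\<^sub>R v) \<le> s * norm u + w * norm v"
      using norm_triangle_ineq[of "s *\<^sub>R u" "w *\<^sub>R v"] that by simp
    also have "\<dots> \<le> t * norm u + t * norm v"
      using that by (intro add_mono mult_right_mono) auto
    also have "\<dots> \<le> t * N"
      using that by (simp add: N_def algebra_simps)
    also have "\<dots> < r"
      using that \<open>N > 0\<close> by (simp add: field_simps)
    finally have "dist (x + s *\<^sub>R u + w *\<^sub>R v) x < r"
      by (simp add: dist_norm add.assoc)
    then have *: "dist (x + s *\<^sub>R u + w *\<^sub>R v) x < r1" "x + s *\<^sub>R u + w *\<^sub>R v \<in> ball x r2"
      by (simp_all add: r_def dist_commute)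
    show "x + s *\<^sub>R u + w *\<^sub>R v \<in> U"
      using *(2) r2(2) by blast
    show "\<bar>G (x + s *\<^sub>R u + w *\<^sub>R v) v - G x v\<bar> < e"
      using r1(2)[OF *(1)] by (simp add: dist_real_def)
  qed
  have main: "\<bar>F (x + t *\<^sub>R u + t *\<^sub>R v) - F (x + t *\<^sub>R u) - F (x + t *\<^sub>R v) + F x - t\<^sup>2 * G x v\<bar> \<le> e * t\<^sup>2"
    if t: "0 < t" "t < r / N" for t
  proof -
    \<comment> \<open>The second difference is \<open>g t - g 0\<close>. The mean value theorem
      along \<open>u\<close> turns it into \<open>t * g' s\<close>. Since \<open>g' s\<close> is
      itself the difference \<open>k t - k 0\<close> along \<open>v\<close>, a second mean value
      gives \<open>t\<^sup>2\<close> times a value of \<open>G\<close> near \<open>x\<close>, which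
      continuity compares with \<open>G x v\<close>.\<close>
    define g where "g s = F (x + s *\<^sub>R u + t *\<^sub>R v) - F (x + s *\<^sub>R u)" for s
    define g' where "g' s = F' (x + s *\<^sub>R u + t *\<^sub>R v) u - F' (x + s *\<^sub>R u) u" for s
    have dg: "(g has_real_derivative g' s) (at s)" if "0 \<le> s" "s \<le> t" for s
    proof -
      have 1: "x + s *\<^sub>R u + t *\<^sub>R v \<in> U" using near(1)[of s t t] that t by simp
      have 2: "x + s *\<^sub>R u \<in> U" using near(1)[of s t 0] that t by simp
      have "((\<lambda>s. F (x + s *\<^sub>R u + t *\<^sub>R v)) has_derivative (\<lambda>h. F' (x + s *\<^sub>R u + t *\<^sub>R v) (h *\<^sub>R u))) (at s)"
        by (rule has_derivative_compose[where f = "\<lambda>s. x + s *\<^sub>R u + t *\<^sub>R v" and g = F, OF _ F[OF 1]]) (auto intro!: derivative_eq_intros)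
      moreover have "((\<lambda>s. F (x + s *\<^sub>R u)) has_derivative (\<lambda>h. F' (x + s *\<^sub>R u) (h *\<^sub>R u))) (at s)"
        by (rule has_derivative_compose[where f = "\<lambda>s. x + s *\<^sub>R u" and g = F, OF _ F[OF 2]]) (auto intro!: derivative_eq_intros)
      ultimately have "(g has_derivative (\<lambda>h. F' (x + s *\<^sub>R u + t *\<^sub>R v) (h *\<^sub>R u) - F' (x + s *\<^sub>R u) (h *\<^sub>R u))) (at s)"
        unfolding g_def by (rule has_derivative_diff)
      moreover have "(\<lambda>h. F' (x + s *\<^sub>R u + t *\<^sub>R v) (h *\<^sub>R u) - F' (x + s *\<^sub>R u) (h *\<^sub>R u)) = (\<lambda>h. g' s * h)"
        using has_derivative_linear[OF F[OF 1]] has_derivative_linear[OF F[OF 2]]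
        by (auto simp: linear_cmul g'_def algebra_simps fun_eq_iff)
      ultimately show ?thesis by (simp add: has_field_derivative_def)
    qed
    obtain s where s: "0 < s" "s < t" "g t - g 0 = t * g' s"
      using MVT2[of 0 t g g'] dg t by auto
    define k where "k w = F' (x + s *\<^sub>R u + w *\<^sub>R v) u" for w
    define k' where "k' w = G (x + s *\<^sub>R u + w *\<^sub>R v) v" for w
    have dk: "(k has_real_derivative k' w) (at w)" if "0 \<le> w" "w \<le> t" for w
    proof -
      have 1: "x + s *\<^sub>R u + w *\<^sub>R v \<in> U" using near(1)[of s t w] that t s by simp
      have "((\<lambda>w. F' (x + s *\<^sub>R u + w *\<^sub>R v) u) has_derivative (\<lambda>h. G (x + s *\<^sub>R u + w *\<^sub>R v) (h *\<^sub>R v))) (at w)"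
        by (rule has_derivative_compose[where f = "\<lambda>w. x + s *\<^sub>R u + w *\<^sub>R v" and g = "\<lambda>z. F' z u", OF _ G[OF 1]]) (auto intro!: derivative_eq_intros)
      moreover have "(\<lambda>h. G (x + s *\<^sub>R u + w *\<^sub>R v) (h *\<^sub>R v)) = (\<lambda>h. k' w * h)"
        using has_derivative_linear[OF G[OF 1]] by (auto simp: linear_cmul k'_def fun_eq_iff)
      ultimately show ?thesis by (simp add: has_field_derivative_def k_def[abs_def])
    qed
    obtain w where w: "0 < w" "w < t" "k t - k 0 = t * k' w"
      using MVT2[of 0 t k k'] dk t by auto
    have "F (x + t *\<^sub>R u + t *\<^sub>R v) - F (x + t *\<^sub>R u) - F (x + t *\<^sub>R v) + F x = g t - g 0"
      by (simp add: g_def)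
    also have "\<dots> = t\<^sup>2 * k' w"
      using s(3) w(3) by (simp add: g'_def k_def power2_eq_square)
    finally have eq: "F (x + t *\<^sub>R u + t *\<^sub>R v) - F (x + t *\<^sub>R u) - F (x + t *\<^sub>R v) + F x - t\<^sup>2 * G x v
        = t\<^sup>2 * (k' w - G x v)"
      by (simp add: algebra_simps)
    have "\<bar>k' w - G x v\<bar> \<le> e"
      using near(2)[of s t w] s w t by (simp add: k'_def)
    then show ?thesis
      unfolding eq by (simp add: abs_mult mult.commute[of e] mult_left_mono)
  qed
  show ?thesis
    unfolding eventually_at_right_field using main \<open>r > 0\<close> \<open>N > 0\<close>
    by (intro exI[of _ "r / N"]) auto
qed

lemma smooth_on_imp_has_derivative:
  assumes "smooth_on U F" "x \<in> U"
  shows "(F has_derivative frechet_derivative F (at x)) (at x)"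
proof -
  have "Ck_on (Suc 0) U F" using assms unfolding smooth_on_def by blast
  then show ?thesis using assms(2) frechet_derivative_works by auto
qed

lemma smooth_on_imp_continuous_on: "smooth_on U F \<Longrightarrow> continuous_on U F"
  unfolding smooth_on_def by (metis Ck_on.simps(1))

lemma smooth_on_frechet_derivative:
  assumes "smooth_on U F"
  shows "smooth_on U (\<lambda>x. frechet_derivative F (at x) v)"
  unfolding smooth_on_def
proof
  fix k
  have "Ck_on (Suc k) U F" using assms unfolding smooth_on_def by blast
  then show "Ck_on k U (\<lambda>x. frechet_derivative F (at x) v)" by simp
qed

lemma smooth_on_partial: "smooth_on U F \<Longrightarrow> smooth_on U (partial i F)"
  unfolding partial_def[abs_def] by (rule smooth_on_frechet_derivative)

text \<open>Pairing with an arbitrary vector \<open>p\<close> reduces the claim to real functions,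
  to which the mean value theorem applies. There \<open>t\<^sup>2 * (p \<bullet> H u v x)\<close>
  and \<open>t\<^sup>2 * (p \<bullet> H v u x)\<close> approximate the same second
  difference.\<close>

lemma second_derivative_commute:
  fixes F :: "'a::real_normed_vector \<Rightarrow> 'b::real_inner"
  assumes U: "open U" "x \<in> U" and F: "smooth_on U F"
  shows "frechet_derivative (\<lambda>y. frechet_derivative F (at y) u) (at x) v
       = frechet_derivative (\<lambda>y. frechet_derivative F (at y) v) (at x) u"
proof -
  define D where "D u y = frechet_derivative F (at y) u" for u y
  define H where "H u v y = frechet_derivative (D u) (at y) v" for u v y
  have smooth_D: "smooth_on U (D u)" for u
    unfolding D_def[abs_def] using F by (rule smooth_on_frechet_derivative)
  have cont_H: "continuous_on U (H u v)" for u v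
    unfolding H_def[abs_def] using smooth_D[THEN smooth_on_frechet_derivative]
    by (rule smooth_on_imp_continuous_on)
  have eq: "p \<bullet> H u v x = p \<bullet> H v u x" for p
  proof (rule ccontr)
    assume neq: "p \<bullet> H u v x \<noteq> p \<bullet> H v u x"
    \<comment> \<open>The two values lie \<open>3 * e\<close> apart, whereas two approximations of
      one second difference allow a gap of at most \<open>2 * e\<close>.\<close>
    define e where "e = \<bar>p \<bullet> H u v x - p \<bullet> H v u x\<bar> / 3"
    have "e > 0" using neq by (simp add: e_def)
    define \<Delta> where "\<Delta> u v t = p \<bullet> F (x + t *\<^sub>R u + t *\<^sub>R v) - p \<bullet> F (x + t *\<^sub>R u)
      - p \<bullet> F (x + t *\<^sub>R v) + p \<bullet> F x" for u v :: 'a and t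
    have approx: "\<forall>\<^sub>F t in at_right 0. \<bar>\<Delta> u v t - t\<^sup>2 * (p \<bullet> H u v x)\<bar> \<le> e * t\<^sup>2" for u v
      unfolding \<Delta>_def
    proof (rule second_difference_approx[where F = "\<lambda>y. p \<bullet> F y" and F' = "\<lambda>y u. p \<bullet> D u y"
          and G = "\<lambda>y v. p \<bullet> H u v y", OF U])
      show "((\<lambda>y. p \<bullet> F y) has_derivative (\<lambda>u. p \<bullet> D u y)) (at y)" if "y \<in> U" for y
        unfolding D_def
        by (rule has_derivative_inner_right[OF smooth_on_imp_has_derivative[OF F that]])
      show "((\<lambda>z. p \<bullet> D u z) has_derivative (\<lambda>v. p \<bullet> H u v y)) (at y)" if "y \<in> U" for y
        unfolding H_def
        by (rule has_derivative_inner_right[OF smooth_on_imp_has_derivative[OF smooth_D that]])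
      show "continuous_on U (\<lambda>y. p \<bullet> H u v y)"
        by (intro continuous_intros cont_H)
    qed (use \<open>e > 0\<close> in auto)
    have "\<forall>\<^sub>F t in at_right 0. \<bar>\<Delta> u v t - t\<^sup>2 * (p \<bullet> H u v x)\<bar> \<le> e * t\<^sup>2 \<and>
        \<bar>\<Delta> v u t - t\<^sup>2 * (p \<bullet> H v u x)\<bar> \<le> e * t\<^sup>2 \<and> t > 0"
      using approx[of u v] approx[of v u] eventually_at_right_less[of 0] by eventually_elim auto
    then obtain t where t: "\<bar>\<Delta> u v t - t\<^sup>2 * (p \<bullet> H u v x)\<bar> \<le> e * t\<^sup>2"
        "\<bar>\<Delta> v u t - t\<^sup>2 * (p \<bullet> H v u x)\<bar> \<le> e * t\<^sup>2" "t > 0"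
      using eventually_happens'[OF trivial_limit_at_right_real] by blast
    have "\<Delta> u v t = \<Delta> v u t"
      unfolding \<Delta>_def by (simp add: add.assoc add.commute[of "t *\<^sub>R v"])
    then have "\<bar>t\<^sup>2 * (p \<bullet> H u v x) - t\<^sup>2 * (p \<bullet> H v u x)\<bar> \<le> 2 * e * t\<^sup>2"
      using t by linarith
    moreover have "t\<^sup>2 * (p \<bullet> H u v x) - t\<^sup>2 * (p \<bullet> H v u x) = t\<^sup>2 * (p \<bullet> H u v x - p \<bullet> H v u x)"
      by (simp only: right_diff_distrib)
    ultimately have "t\<^sup>2 * (3 * e) \<le> t\<^sup>2 * (2 * e)"
      by (simp add: e_def abs_mult mult_ac)
    then show False using t(3) \<open>e > 0\<close> by simp
  qed
  have "H u v x = H v u x"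
    using eq vector_eq_ldot by blast
  then show ?thesis by (simp add: H_def D_def[abs_def])
qed

lemma partial_commute:
  fixes F :: "real^'n \<Rightarrow> 'b::real_inner"
  assumes "open U" "x \<in> U" "smooth_on U F"
  shows "partial i (partial j F) x = partial j (partial i F) x"
  using second_derivative_commute[OF assms, of "axis j 1" "axis i 1"]
  unfolding partial_def[abs_def] .

section \<open>Rules for partial derivatives\<close>

lemma partial_eq:
  "(F has_derivative F') (at x) \<Longrightarrow> partial i F x = F' (axis i 1)"
  unfolding partial_def using frechet_derivative_at by metis

lemma smooth_on_imp_differentiable:
  "smooth_on U F \<Longrightarrow> x \<in> U \<Longrightarrow> F differentiable at x"
  using smooth_on_imp_has_derivative differentiableI by blast

lemma partial_cong:
  assumes "open U" "x \<in> U" "\<And>y. y \<in> U \<Longrightarrow> F y = G y"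
  shows "partial i F x = partial i G x"
proof -
  \<comment> \<open>\<open>frechet_derivative\<close> chooses among all derivatives, so it is enough
    that \<open>F\<close> and \<open>G\<close> have the same derivatives at \<open>x\<close>;
    differentiability need not be known.\<close>
  have "(F has_derivative F') (at x) \<longleftrightarrow> (G has_derivative F') (at x)" for F'
    using has_derivative_transform_within_open[OF _ assms(1,2), of F F' UNIV G]
      has_derivative_transform_within_open[OF _ assms(1,2), of G F' UNIV F] assms(3) by auto
  then show ?thesis by (simp add: partial_def frechet_derivative_def)
qed

lemma partial_inner:
  assumes "F differentiable at x" "G differentiable at x"
  shows "partial i (\<lambda>y. F y \<bullet> G y) x = partial i F x \<bullet> G x + F x \<bullet> partial i G x"
  using partial_eq[OF has_derivative_inner[OF assms[unfolded frechet_derivative_works]], of i]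
  by (simp add: partial_def)

lemma partial_scaleR:
  assumes "c differentiable at x" "G differentiable at x"
  shows "partial i (\<lambda>y. c y *\<^sub>R G y) x = partial i c x *\<^sub>R G x + c x *\<^sub>R partial i G x"
  using partial_eq[OF has_derivative_scaleR[OF assms[unfolded frechet_derivative_works]], of i]
  by (simp add: partial_def)

lemma partial_diff:
  assumes "F differentiable at x" "G differentiable at x"
  shows "partial i (\<lambda>y. F y - G y) x = partial i F x - partial i G x"
  using partial_eq[OF has_derivative_diff[OF assms[unfolded frechet_derivative_works]], of i]
  by (simp add: partial_def)

lemma partial_sum:
  assumes "\<And>k. k \<in> K \<Longrightarrow> F k differentiable at x"
  shows "partial i (\<lambda>y. \<Sum>k\<in>K. F k y) x = (\<Sum>k\<in>K. partial i (F k) x)"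
proof -
  have "((\<lambda>y. \<Sum>k\<in>K. F k y) has_derivative (\<lambda>h. \<Sum>k\<in>K. frechet_derivative (F k) (at x) h)) (at x)"
    using assms by (intro has_derivative_sum) (simp add: frechet_derivative_works)
  then show ?thesis using partial_eq by (fastforce simp: partial_def)
qed

lemma frechet_derivative_eq_sum_partial:
  fixes F :: "real^'n \<Rightarrow> 'b::real_normed_vector"
  assumes "F differentiable at x"
  shows "frechet_derivative F (at x) X = (\<Sum>i\<in>UNIV. X $ i *\<^sub>R partial i F x)"
proof -
  have lin: "linear (frechet_derivative F (at x))"
    using assms by (rule linear_frechet_derivative)
  have "X = (\<Sum>i\<in>UNIV. X $ i *\<^sub>R axis i 1)"
    using basis_expansion[of X] by (simp add: scalar_mult_eq_scaleR)
  then have "frechet_derivative F (at x) X = frechet_derivative F (at x) (\<Sum>i\<in>UNIV. X $ i *\<^sub>R axis i 1)"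
    by simp
  then show ?thesis
    by (simp add: linear_sum[OF lin] linear_cmul[OF lin] partial_def)
qed

section \<open>Linear systems with differentiable coefficients\<close>

text \<open>By the Leibniz expansion the determinant is a polynomial in the entries.\<close>

lemma differentiable_det:
  fixes B :: "'a::real_normed_vector \<Rightarrow> real^'n^'n"
  assumes "\<And>i j. (\<lambda>y. B y $ i $ j) differentiable at x"
  shows "(\<lambda>y. det (B y)) differentiable at x"
proof -
  have prod: "(\<lambda>y. \<Prod>i\<in>I. B y $ i $ p i) differentiable at x" if "finite I" for I and p :: "'n \<Rightarrow> 'n"
    using that by induction (auto intro!: differentiable_mult assms)
  show ?thesis unfolding det_def
    by (intro differentiable_sum differentiable_mult differentiable_const prod ballI)
      (auto simp: finite_permutations)
qed

lemma matrix_inv_mult: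
  fixes B :: "real^'n^'n"
  assumes "det B \<noteq> 0"
  shows "B ** matrix_inv B = mat 1"
proof -
  have "\<exists>C. B ** C = mat 1 \<and> C ** B = mat 1"
    using assms invertible_det_nz[of B] invertible_def by blast
  then show ?thesis unfolding matrix_inv_def by (rule someI2_ex) blast
qed

text \<open>Cramer's rule writes each component of the solution of a linear system as a quotient of
  two determinants, and the denominator does not vanish on \<open>U\<close>. This will give the
  differentiability of the Christoffel symbols.\<close>

lemma differentiable_matrix_inv_vector:
  fixes B :: "'a::real_normed_vector \<Rightarrow> real^'n^'n"
  assumes U: "open U" "x \<in> U" and det: "\<And>y. y \<in> U \<Longrightarrow> det (B y) \<noteq> 0"
    and B: "\<And>i j. (\<lambda>y. B y $ i $ j) differentiable at x"
    and b: "\<And>i. (\<lambda>y. b y $ i) differentiable at x"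
  shows "(\<lambda>y. (matrix_inv (B y) *v b y) $ k) differentiable at x"
proof -
  let ?q = "\<lambda>y. det (\<chi> i j. if j = k then b y $ i else B y $ i $ j) / det (B y)"
  have eq: "?q y = (matrix_inv (B y) *v b y) $ k" if "y \<in> U" for y
  proof -
    have "B y *v (matrix_inv (B y) *v b y) = b y"
      by (simp add: matrix_vector_mul_assoc matrix_inv_mult det[OF that])
    then show ?thesis by (simp only: cramer[OF det[OF that]] vec_lambda_beta)
  qed
  have entry: "(\<lambda>y. if j = k then b y $ i else B y $ i $ j) differentiable at x" for i j
    by (cases "j = k") (simp_all add: B b)
  have "(\<lambda>y. det (\<chi> i j. if j = k then b y $ i else B y $ i $ j)) differentiable at x"
    by (rule differentiable_det) (simp add: entry)
  then have "?q differentiable at x"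
    using differentiable_det[OF B] det U by (intro differentiable_divide) auto
  then show ?thesis
    unfolding differentiable_def using has_derivative_transform_within_open[OF _ U eq] by fast
qed

subsection \<open>The Gauss equation in a chart\<close>

text \<open>The orthogonal splitting is unique: two candidates differ by a vector that lies in
  \<open>T\<close> and in its orthogonal complement, hence is orthogonal to itself.\<close>

lemma normal_component_eqI:
  assumes "subspace T" "n \<in> T\<^sup>\<bottom>" "w - n \<in> T"
  shows "normal_component T w = n"
  unfolding normal_component_def
proof (rule the_equality)
  fix n' assume n': "n' \<in> T\<^sup>\<bottom> \<and> w - n' \<in> T"
  have "n' - n \<in> T\<^sup>\<bottom>"
    using n' assms(2) subspace_diff[OF subspace_orthogonal_comp] by blast
  moreover have "(w - n) - (w - n') \<in> T"
    using n' assms by (blast intro: subspace_diff)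
  then have "n' - n \<in> T" by (simp add: algebra_simps)
  ultimately have "orthogonal (n' - n) (n' - n)"
    unfolding orthogonal_comp_def by blast
  then show "n' = n" by (simp add: orthogonal_def)
qed (use assms in auto)

text \<open>The local setting: \<phi> stands for the immersion read in one inverse chart with domain
  \<open>U\<close>, so that the curvature computation is pure calculus on an open set.\<close>

locale immersed_patch =
  fixes U :: "(real^'n) set" and \<phi> :: "real^'n \<Rightarrow> 'b::euclidean_space"
  assumes open_U: "open U" and smooth: "smooth_on U \<phi>"
    and inj_derivative: "\<And>y. y \<in> U \<Longrightarrow> inj (frechet_derivative \<phi> (at y))"
begin

abbreviation "G \<equiv> induced_metric \<phi>"

abbreviation hess :: "'n \<Rightarrow> 'n \<Rightarrow> real^'n \<Rightarrow> 'b" where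
  "hess i j \<equiv> partial i (partial j \<phi>)"

text \<open>The image of the Levi-Civita derivative \<nabla> of the \<open>j\<close>-th coordinate
  field along the \<open>i\<close>-th one under the differential of \<phi>.\<close>

definition tangential :: "'n \<Rightarrow> 'n \<Rightarrow> real^'n \<Rightarrow> 'b" where
  "tangential i j y = (\<Sum>k\<in>UNIV. christoffel G k i j y *\<^sub>R partial k \<phi> y)"

text \<open>The coefficients of the second fundamental form on coordinate fields; that they are
  normal is shown in \<open>normal_hess_inner\<close>.\<close>

definition normal_hess :: "'n \<Rightarrow> 'n \<Rightarrow> real^'n \<Rightarrow> 'b" where
  "normal_hess i j y = hess i j y - tangential i j y"

lemma differentiable_phi: "y \<in> U \<Longrightarrow> \<phi> differentiable at y"
  using smooth smooth_on_imp_differentiable by blast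

lemma differentiable_partial_phi: "y \<in> U \<Longrightarrow> partial i \<phi> differentiable at y"
  using smooth smooth_on_partial smooth_on_imp_differentiable by blast

lemma differentiable_hess: "y \<in> U \<Longrightarrow> hess i j differentiable at y"
  using smooth smooth_on_partial smooth_on_imp_differentiable by blast

lemma hess_commute: "y \<in> U \<Longrightarrow> hess i j y = hess j i y"
  using partial_commute[OF open_U _ smooth] by blast

lemma derivative_phi:
  "y \<in> U \<Longrightarrow> frechet_derivative \<phi> (at y) X = (\<Sum>i\<in>UNIV. X $ i *\<^sub>R partial i \<phi> y)"
  using frechet_derivative_eq_sum_partial differentiable_phi by blast

section \<open>The induced metric and its Christoffel symbols\<close>

lemma metric_inner_induced:
  assumes "y \<in> U"
  shows "metric_inner G y X Y = frechet_derivative \<phi> (at y) X \<bullet> frechet_derivative \<phi> (at y) Y"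
  unfolding metric_inner_def derivative_phi[OF assms]
  by (simp add: inner_vec_def matrix_vector_mult_def induced_metric_def inner_sum_left
      inner_sum_right sum_distrib_left mult_ac) (rule sum.swap)

text \<open>A vector in the kernel of the Gram matrix has an image of length zero under the
  differential, which is injective.\<close>

lemma det_metric_nonzero:
  assumes "y \<in> U"
  shows "det (G y) \<noteq> 0"
proof -
  have "X = 0" if "G y *v X = 0" for X
  proof -
    have "frechet_derivative \<phi> (at y) X \<bullet> frechet_derivative \<phi> (at y) X = 0"
      using metric_inner_induced[OF assms, of X X] that by (simp add: metric_inner_def)
    then show ?thesis
      using inj_derivative[OF assms] linear_frechet_derivative[OF differentiable_phi[OF assms]]
      by (simp add: linear_injective_0)
  qed
  then show ?thesis
    by (metis invertible_det_nz invertible_left_inverse matrix_left_invertible_ker)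
qed

lemma partial_metric:
  assumes "y \<in> U"
  shows "partial k (\<lambda>z. G z $ i $ j) y = hess k i y \<bullet> partial j \<phi> y + partial i \<phi> y \<bullet> hess k j y"
  using partial_inner[OF differentiable_partial_phi[OF assms] differentiable_partial_phi[OF assms]]
  by (simp add: induced_metric_def)

text \<open>Expanding the three derivatives of the metric by the product rule, all terms cancel by
  symmetry of \<open>hess\<close> except two copies of
  \<open>hess i j y \<bullet> partial m \<phi> y\<close>. The Christoffel symbols thus solve the
  normal equations for projecting \<open>hess i j y\<close> onto the tangent space.\<close>

lemma christoffel_eq:
  assumes "y \<in> U"
  shows "christoffel G k i j y = (matrix_inv (G y) *v (\<chi> m. hess i j y \<bullet> partial m \<phi> y)) $ k"
proof -
  have "partial i (\<lambda>z. G z $ j $ m) y + partial j (\<lambda>z. G z $ i $ m) y - partial m (\<lambda>z. G z $ i $ j) y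
      = 2 * (hess i j y \<bullet> partial m \<phi> y)" for m
    using hess_commute[OF assms, of j i] hess_commute[OF assms, of m i] hess_commute[OF assms, of m j]
    by (simp add: partial_metric[OF assms] inner_commute)
  then show ?thesis
    by (simp add: christoffel_def matrix_vector_mult_def sum_distrib_left sum_divide_distrib)
qed

lemma christoffel_commute: "y \<in> U \<Longrightarrow> christoffel G k i j y = christoffel G k j i y"
  using hess_commute[of y i j] by (simp add: christoffel_eq)

text \<open>The curvature coefficients contain derivatives of these symbols. The form in
  \<open>christoffel_eq\<close> is the solution of a linear system with differentiable data.\<close>

lemma differentiable_christoffel:
  assumes "y \<in> U"
  shows "christoffel G k i j differentiable at y"
proof -
  have "(\<lambda>z. (matrix_inv (G z) *v (\<chi> m. hess i j z \<bullet> partial m \<phi> z)) $ k) differentiable at y"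
    using assms det_metric_nonzero
    by (intro differentiable_matrix_inv_vector[OF open_U])
      (auto simp: induced_metric_def intro!: differentiable_inner differentiable_hess differentiable_partial_phi)
  then show ?thesis
    unfolding differentiable_def
    using has_derivative_transform_within_open[OF _ open_U assms christoffel_eq[symmetric]] by fast
qed

text \<open>Multiplying \<open>christoffel_eq\<close> by the Gram matrix cancels its inverse. Hence
  \<open>tangential i j\<close> is the orthogonal projection of \<open>hess i j\<close> onto the
  tangent space.\<close>

lemma tangential_inner:
  assumes "y \<in> U"
  shows "tangential i j y \<bullet> partial m \<phi> y = hess i j y \<bullet> partial m \<phi> y"
proof -
  let ?b = "\<chi> m. hess i j y \<bullet> partial m \<phi> y"
  have "(\<chi> k. christoffel G k i j y) = matrix_inv (G y) *v ?b"
    by (simp add: vec_eq_iff christoffel_eq[OF assms])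
  then have "G y *v (\<chi> k. christoffel G k i j y) = ?b"
    by (simp add: matrix_vector_mul_assoc matrix_inv_mult det_metric_nonzero[OF assms])
  then have "(G y *v (\<chi> k. christoffel G k i j y)) $ m = ?b $ m"
    by simp
  then show ?thesis
    by (simp add: tangential_def matrix_vector_mult_def induced_metric_def inner_sum_left
        inner_commute[of "partial m \<phi> y"] mult.commute)
qed

section \<open>Normal part of the second derivatives and the Gauss equation\<close>

lemma normal_hess_inner: "y \<in> U \<Longrightarrow> normal_hess i j y \<bullet> partial m \<phi> y = 0"
  by (simp add: normal_hess_def inner_diff_left tangential_inner)

lemma normal_hess_inner_tangential: "y \<in> U \<Longrightarrow> normal_hess i j y \<bullet> tangential k m y = 0"
  by (simp add: tangential_def inner_sum_right normal_hess_inner)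

lemma normal_hess_inner_hess:
  "y \<in> U \<Longrightarrow> normal_hess i j y \<bullet> hess k m y = normal_hess i j y \<bullet> normal_hess k m y"
  using normal_hess_inner_tangential[of y i j k m] by (simp add: normal_hess_def[of k m] inner_diff_right)

lemma normal_hess_commute: "y \<in> U \<Longrightarrow> normal_hess i j y = normal_hess j i y"
  using hess_commute[of y i j] christoffel_commute[of y _ i j]
  by (simp add: normal_hess_def tangential_def)

lemma differentiable_tangential: "y \<in> U \<Longrightarrow> tangential i j differentiable at y"
  unfolding tangential_def[abs_def]
  by (intro differentiable_sum differentiable_scaleR differentiable_christoffel differentiable_partial_phi ballI) auto

lemma differentiable_normal_hess: "y \<in> U \<Longrightarrow> normal_hess i j differentiable at y"
  unfolding normal_hess_def[abs_def]
  by (intro differentiable_diff differentiable_tangential differentiable_hess) auto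

lemma partial_tangential:
  assumes "y \<in> U"
  shows "partial i (tangential j k) y
    = (\<Sum>m\<in>UNIV. partial i (christoffel G m j k) y *\<^sub>R partial m \<phi> y + christoffel G m j k y *\<^sub>R hess i m y)"
proof -
  have "partial i (tangential j k) y
      = (\<Sum>m\<in>UNIV. partial i (\<lambda>y. christoffel G m j k y *\<^sub>R partial m \<phi> y) y)"
    unfolding tangential_def[abs_def]
    by (intro partial_sum differentiable_scaleR differentiable_christoffel differentiable_partial_phi assms)
  then show ?thesis
    by (simp add: partial_scaleR differentiable_christoffel differentiable_partial_phi assms)
qed

text \<open>This is the Weingarten equation: the product rule applied to
  \<open>normal_hess_inner\<close> moves the derivative onto \<open>partial p \<phi>\<close>, and
  only the normal part of the resulting \<open>hess i p\<close> contributes.\<close>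

lemma partial_normal_hess_inner:
  assumes "y \<in> U"
  shows "partial i (normal_hess j k) y \<bullet> partial p \<phi> y = - (normal_hess j k y \<bullet> normal_hess i p y)"
proof -
  have "partial i (\<lambda>z. normal_hess j k z \<bullet> partial p \<phi> z) y = partial i (\<lambda>z. 0) y"
    by (rule partial_cong[OF open_U assms normal_hess_inner])
  also have "\<dots> = 0"
    by (simp add: partial_def)
  finally show ?thesis
    using partial_inner[OF differentiable_normal_hess[OF assms] differentiable_partial_phi[OF assms]]
      normal_hess_inner_hess[OF assms]
    by simp
qed

text \<open>Third derivatives of \<phi> commute, so the antisymmetrised derivatives of the
  tangential parts are minus those of the normal parts. Pairing with
  \<open>partial p \<phi> y\<close> removes undifferentiated normal terms, and the Weingarten
  equation evaluates the rest.\<close>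

lemma gauss_equation_coeff:
  assumes "y \<in> U"
  shows "(\<Sum>m\<in>UNIV. riemann_coeff G m i j k y *\<^sub>R partial m \<phi> y) \<bullet> partial p \<phi> y
    = normal_hess j k y \<bullet> normal_hess i p y - normal_hess i k y \<bullet> normal_hess j p y"
proof -
  let ?C = "\<lambda>m i j. christoffel G m i j y"
  \<comment> \<open>The terms quadratic in the Christoffel symbols recombine into tangential parts
    of second derivatives.\<close>
  have dd: "(\<Sum>m\<in>UNIV. (\<Sum>s\<in>UNIV. ?C s j k * ?C m i s) *\<^sub>R partial m \<phi> y)
      = (\<Sum>s\<in>UNIV. ?C s j k *\<^sub>R tangential i s y)" for i j
    unfolding tangential_def scaleR_sum_right scaleR_sum_left by (subst sum.swap) simp
  have "(\<Sum>m\<in>UNIV. riemann_coeff G m i j k y *\<^sub>R partial m \<phi> y)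
      = (\<Sum>m\<in>UNIV. partial i (christoffel G m j k) y *\<^sub>R partial m \<phi> y)
        - (\<Sum>m\<in>UNIV. partial j (christoffel G m i k) y *\<^sub>R partial m \<phi> y)
        + ((\<Sum>s\<in>UNIV. ?C s j k *\<^sub>R tangential i s y) - (\<Sum>s\<in>UNIV. ?C s i k *\<^sub>R tangential j s y))"
    unfolding dd[symmetric] riemann_coeff_def
    by (simp only: sum_subtractf sum.distrib scaleR_left_diff_distrib scaleR_left_distrib)
  \<comment> \<open>The derivative of \<open>tangential j k\<close> produces \<open>hess i s\<close>
    where the sum has \<open>tangential i s\<close>; the difference is
    \<open>normal_hess i s\<close>.\<close>
  also have "\<dots> = partial i (tangential j k) y - partial j (tangential i k) y
        - (\<Sum>s\<in>UNIV. ?C s j k *\<^sub>R normal_hess i s y) + (\<Sum>s\<in>UNIV. ?C s i k *\<^sub>R normal_hess j s y)"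
    by (simp add: partial_tangential[OF assms] normal_hess_def sum.distrib sum_subtractf scaleR_right_diff_distrib)
  \<comment> \<open>Here third derivatives commute:
    \<open>partial i (hess j k) y = partial j (hess i k) y\<close>, which swaps tangential for
    normal parts with a change of sign.\<close>
  also have "\<dots> = partial j (normal_hess i k) y - partial i (normal_hess j k) y
        - (\<Sum>s\<in>UNIV. ?C s j k *\<^sub>R normal_hess i s y) + (\<Sum>s\<in>UNIV. ?C s i k *\<^sub>R normal_hess j s y)"
    using partial_commute[OF open_U assms smooth_on_partial[OF smooth], of i j k]
    by (simp add: normal_hess_def[abs_def] partial_diff differentiable_hess differentiable_tangential assms)
  finally show ?thesis
    by (simp add: inner_add_left inner_diff_left inner_sum_left normal_hess_inner
        partial_normal_hess_inner assms)
qed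

section \<open>The second fundamental form of a patch\<close>

definition second_form :: "real^'n \<Rightarrow> real^'n \<Rightarrow> real^'n \<Rightarrow> 'b" where
  "second_form y X Y = (\<Sum>i\<in>UNIV. \<Sum>j\<in>UNIV. (X $ i * Y $ j) *\<^sub>R normal_hess i j y)"

lemma second_form_inner:
  "second_form y X Y \<bullet> w = (\<Sum>i\<in>UNIV. \<Sum>j\<in>UNIV. X $ i * Y $ j * (normal_hess i j y \<bullet> w))"
  by (simp add: second_form_def inner_sum_left)

lemma second_form_commute:
  assumes "y \<in> U"
  shows "second_form y X Y = second_form y Y X"
  unfolding second_form_def
  by (subst sum.swap) (simp add: normal_hess_commute[OF assms] mult.commute)

text \<open>The equation for coefficients is contracted with
  \<open>X $ i * Y $ j * Y $ k * X $ p\<close>.\<close>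

lemma gauss_equation:
  assumes "y \<in> U"
  shows "metric_inner G y (riemann G y X Y Y) X
    = second_form y X X \<bullet> second_form y Y Y - (norm (second_form y X Y))\<^sup>2"
proof -
  let ?R = "\<lambda>i j k. \<Sum>m\<in>UNIV. riemann_coeff G m i j k y *\<^sub>R partial m \<phi> y"
  have "frechet_derivative \<phi> (at y) (riemann G y X Y Y)
      = (\<Sum>m\<in>UNIV. \<Sum>i\<in>UNIV. \<Sum>j\<in>UNIV. \<Sum>k\<in>UNIV. (X $ i * Y $ j * Y $ k * riemann_coeff G m i j k y) *\<^sub>R partial m \<phi> y)"
    by (simp add: derivative_phi[OF assms] riemann_def scaleR_sum_left)
  \<comment> \<open>Three interchanges move the sum over \<open>m\<close> to the innermost
    place.\<close>
  also have "\<dots> = (\<Sum>i\<in>UNIV. \<Sum>j\<in>UNIV. \<Sum>k\<in>UNIV. (X $ i * Y $ j * Y $ k) *\<^sub>R ?R i j k)"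
    by (rule trans[OF sum.swap], rule sum.cong[OF refl], rule trans[OF sum.swap],
        rule sum.cong[OF refl], rule trans[OF sum.swap]) (simp add: scaleR_sum_right)
  finally have riem: "frechet_derivative \<phi> (at y) (riemann G y X Y Y)
      = (\<Sum>i\<in>UNIV. \<Sum>j\<in>UNIV. \<Sum>k\<in>UNIV. (X $ i * Y $ j * Y $ k) *\<^sub>R ?R i j k)" .
  have "metric_inner G y (riemann G y X Y Y) X
      = (\<Sum>i\<in>UNIV. \<Sum>j\<in>UNIV. \<Sum>k\<in>UNIV. (X $ i * Y $ j * Y $ k) *
          (?R i j k \<bullet> frechet_derivative \<phi> (at y) X))"
    by (simp add: metric_inner_induced[OF assms] riem inner_sum_left)
  also have "\<dots> = (\<Sum>i\<in>UNIV. \<Sum>j\<in>UNIV. \<Sum>k\<in>UNIV. \<Sum>p\<in>UNIV. (X $ i * Y $ j * Y $ k * X $ p) *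
          (?R i j k \<bullet> partial p \<phi> y))"
    by (simp only: derivative_phi[OF assms, of X] inner_sum_right inner_scaleR_right sum_distrib_left mult_ac)
  also have "\<dots> = (\<Sum>i\<in>UNIV. \<Sum>j\<in>UNIV. \<Sum>k\<in>UNIV. \<Sum>p\<in>UNIV. (X $ i * Y $ j * Y $ k * X $ p) *
          (normal_hess j k y \<bullet> normal_hess i p y))
      - (\<Sum>i\<in>UNIV. \<Sum>j\<in>UNIV. \<Sum>k\<in>UNIV. \<Sum>p\<in>UNIV. (X $ i * Y $ j * Y $ k * X $ p) *
          (normal_hess i k y \<bullet> normal_hess j p y))"
    unfolding gauss_equation_coeff[OF assms]
    by (simp only: right_diff_distrib sum_subtractf)
  also have "(\<Sum>i\<in>UNIV. \<Sum>j\<in>UNIV. \<Sum>k\<in>UNIV. \<Sum>p\<in>UNIV. (X $ i * Y $ j * Y $ k * X $ p) *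
          (normal_hess j k y \<bullet> normal_hess i p y)) = second_form y Y Y \<bullet> second_form y X X"
  proof -
    have "(\<Sum>j\<in>UNIV. \<Sum>k\<in>UNIV. \<Sum>p\<in>UNIV. (X $ i * Y $ j * Y $ k * X $ p) *
        (normal_hess j k y \<bullet> normal_hess i p y))
      = second_form y Y Y \<bullet> (\<Sum>p\<in>UNIV. (X $ i * X $ p) *\<^sub>R normal_hess i p y)" for i
      unfolding second_form_inner by (simp add: inner_sum_right sum_distrib_left mult_ac)
    then show ?thesis
      by (simp only: second_form_def[of y X X] inner_sum_right)
  qed
  \<comment> \<open>Now \<open>i\<close> pairs with \<open>k\<close> and \<open>j\<close> with
    \<open>p\<close>, so the sums over \<open>j\<close> and \<open>k\<close> are interchanged before
    they are grouped.\<close>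
  also have "(\<Sum>i\<in>UNIV. \<Sum>j\<in>UNIV. \<Sum>k\<in>UNIV. \<Sum>p\<in>UNIV. (X $ i * Y $ j * Y $ k * X $ p) *
          (normal_hess i k y \<bullet> normal_hess j p y)) = second_form y X Y \<bullet> second_form y Y X"
    unfolding second_form_inner
    by (rule sum.cong[OF refl], rule trans[OF sum.swap])
      (simp add: second_form_def[of y Y X] inner_sum_right sum_distrib_left mult_ac)
  finally show ?thesis
    by (simp add: second_form_commute[OF assms, of Y X] power2_norm_eq_inner inner_commute)
qed

lemma tangential_in_range:
  assumes "y \<in> U"
  shows "tangential i j y \<in> range (frechet_derivative \<phi> (at y))"
proof -
  have "tangential i j y = frechet_derivative \<phi> (at y) (\<chi> k. christoffel G k i j y)"
    by (simp add: tangential_def derivative_phi[OF assms])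
  then show ?thesis by blast
qed

text \<open>The coordinates \<open>Y\<close> are constant, so only the partial derivatives of \<phi>
  are differentiated. The left side is the vector whose normal component defines
  \<open>second_fundamental_form\<close>.\<close>

lemma second_derivative_phi:
  assumes "y \<in> U"
  shows "frechet_derivative (\<lambda>z. frechet_derivative \<phi> (at z) Y) (at y) X
    = (\<Sum>i\<in>UNIV. \<Sum>j\<in>UNIV. (X $ i * Y $ j) *\<^sub>R hess i j y)"
proof -
  let ?V = "\<lambda>z. frechet_derivative \<phi> (at z) Y"
  have "partial i ?V y = (\<Sum>j\<in>UNIV. Y $ j *\<^sub>R hess i j y)" for i
  proof -
    have "partial i ?V y = partial i (\<lambda>z. \<Sum>j\<in>UNIV. Y $ j *\<^sub>R partial j \<phi> z) y"
      by (rule partial_cong[OF open_U assms derivative_phi])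
    also have "\<dots> = (\<Sum>j\<in>UNIV. partial i (\<lambda>z. Y $ j *\<^sub>R partial j \<phi> z) y)"
      by (intro partial_sum differentiable_scaleR differentiable_const differentiable_partial_phi assms)
    also have "\<dots> = (\<Sum>j\<in>UNIV. Y $ j *\<^sub>R hess i j y)"
      using partial_scaleR[OF differentiable_const differentiable_partial_phi[OF assms]]
      by (simp add: partial_def[of _ "\<lambda>_. _"])
    finally show ?thesis .
  qed
  moreover have "?V differentiable at y"
    using smooth_on_frechet_derivative[OF smooth] assms by (rule smooth_on_imp_differentiable)
  ultimately show ?thesis
    by (simp add: frechet_derivative_eq_sum_partial scaleR_sum_right)
qed

text \<open>Links the coordinate form to the geometric definition: subtracting
  \<open>second_form y X Y\<close> from the second derivative leaves a combination of the vectors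
  \<open>tangential i j y\<close>, so this is the orthogonal splitting.\<close>

lemma normal_component_second_derivative:
  assumes "y \<in> U"
  shows "normal_component (range (frechet_derivative \<phi> (at y)))
      (frechet_derivative (\<lambda>z. frechet_derivative \<phi> (at z) Y) (at y) X) = second_form y X Y"
    (is "normal_component ?T ?w = _")
proof (rule normal_component_eqI)
  show T: "subspace ?T"
    using linear_frechet_derivative[OF differentiable_phi[OF assms]]
    by (intro linear_subspace_image) auto
  show "second_form y X Y \<in> ?T\<^sup>\<bottom>"
    by (auto simp: orthogonal_comp_def orthogonal_def inner_commute[of _ "second_form y X Y"]
        second_form_inner derivative_phi[OF assms] inner_sum_right normal_hess_inner[OF assms])
  have "?w - second_form y X Y = (\<Sum>i\<in>UNIV. \<Sum>j\<in>UNIV. (X $ i * Y $ j) *\<^sub>R tangential i j y)"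
    by (simp add: second_derivative_phi[OF assms] second_form_def normal_hess_def
        scaleR_right_diff_distrib sum_subtractf)
  then show "?w - second_form y X Y \<in> ?T"
    by (simp add: subspace_sum subspace_scale T tangential_in_range assms)
qed

end

subsection \<open>Orthonormal bases and mutual curvature\<close>

lemma some_orthonormal_basis:
  assumes "subspace S"
  shows "orthonormal_basis_of S (some_orthonormal_basis S)"
proof -
  obtain B where "pairwise orthogonal B" "\<And>x. x \<in> B \<Longrightarrow> norm x = 1" "span B = S"
    using orthonormal_basis_subspace[OF assms] by metis
  then have "orthonormal_basis_of S B" by (simp add: orthonormal_basis_of_def)
  then show ?thesis unfolding some_orthonormal_basis_def by (rule someI)
qed

lemma some_orthonormal_basis_unit:
  assumes "subspace S" "b \<in> some_orthonormal_basis S"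
  shows "b \<in> S" "norm b = 1"
  using some_orthonormal_basis[OF assms(1)] assms(2) span_base
  unfolding orthonormal_basis_of_def by blast+

section \<open>Passage from charts to the submanifold\<close>

text \<open>The atlas covers the manifold, so the choice in \<open>chart_at\<close> yields a chart
  around \<open>p\<close>, and the local results apply at \<open>coord_at A p\<close>.\<close>

lemma immersed_patch_chart:
  fixes A :: "((real^'n) set \<times> (real^'n \<Rightarrow> 'm)) set" and f :: "'m \<Rightarrow> 'b::euclidean_space"
  assumes "immersed_submanifold M A f" "p \<in> topspace M"
  shows "immersed_patch (fst (chart_at A p)) (local_rep A f p)"
    and "coord_at A p \<in> fst (chart_at A p)"
proof -
  have mfd: "smooth_manifold M A" and imm: "smooth_immersion A f"
    using assms(1) by (simp_all add: immersed_submanifold_def)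
  have "(\<Union>(U, \<psi>)\<in>A. \<psi> ` U) = topspace M"
    using mfd unfolding smooth_manifold_def by (elim conjE)
  then obtain U \<psi> where "(U, \<psi>) \<in> A" "p \<in> \<psi> ` U"
    using assms(2) by blast
  then have "\<exists>c. c \<in> A \<and> p \<in> snd c ` fst c"
    by (intro exI[of _ "(U, \<psi>)"]) simp
  from someI_ex[OF this] have c: "chart_at A p \<in> A" "p \<in> snd (chart_at A p) ` fst (chart_at A p)"
    unfolding chart_at_def by blast+
  show "coord_at A p \<in> fst (chart_at A p)"
    unfolding coord_at_def using c(2) by (rule inv_into_into)
  show "immersed_patch (fst (chart_at A p)) (local_rep A f p)"
  proof
    have "\<forall>(U, \<psi>)\<in>A. open U"
      using mfd unfolding smooth_manifold_def by (auto simp only: case_prod_beta)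
    then show "open (fst (chart_at A p))"
      using c(1) by (simp add: case_prod_beta)
    show "smooth_on (fst (chart_at A p)) (local_rep A f p)"
      using imm c(1) by (auto simp: smooth_immersion_def local_rep_def case_prod_beta)
    show "inj (frechet_derivative (local_rep A f p) (at y))" if "y \<in> fst (chart_at A p)" for y
      using imm c(1) that by (simp add: smooth_immersion_def local_rep_def case_prod_beta)
  qed
qed

lemma subspace_tangent_space:
  assumes "immersed_submanifold M A f" "p \<in> topspace M"
  shows "subspace (tangent_space A f p)"
proof -
  interpret immersed_patch "fst (chart_at A p)" "local_rep A f p"
    using immersed_patch_chart(1)[OF assms] .
  show ?thesis
    unfolding tangent_space_def differential_def
    using linear_frechet_derivative[OF differentiable_phi[OF immersed_patch_chart(2)[OF assms]]]
    by (intro linear_subspace_image) auto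
qed

text \<open>For an orthonormal pair the denominator of the sectional curvature is \<open>1\<close>,
  leaving the numerator given by \<open>gauss_equation\<close>.\<close>

lemma sectional_curvature_gauss:
  assumes M: "immersed_submanifold M A f" "p \<in> topspace M"
    and uv: "u \<in> tangent_space A f p" "v \<in> tangent_space A f p"
      "norm u = 1" "norm v = 1" "orthogonal u v"
  shows "sectional_curvature A f p u v
    = second_fundamental_form A f p u u \<bullet> second_fundamental_form A f p v v
      - (norm (second_fundamental_form A f p u v))\<^sup>2"
proof -
  interpret immersed_patch "fst (chart_at A p)" "local_rep A f p"
    using immersed_patch_chart(1)[OF M] .
  let ?x = "coord_at A p"
  note x = immersed_patch_chart(2)[OF M]
  \<comment> \<open>\<open>inv\<close> is a left inverse because the differential is
    injective.\<close>
  have coords: "tangent_coords A f p (differential A f p X) = X" for X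
    unfolding tangent_coords_def using inj_derivative[OF x] by (simp add: differential_def)
  have sff: "second_fundamental_form A f p (differential A f p X) (differential A f p Y)
      = second_form ?x X Y" for X Y
    using normal_component_second_derivative[OF x]
    unfolding second_fundamental_form_def coords Let_def
    by (simp add: tangent_space_def differential_def)
  obtain X Y where XY: "u = differential A f p X" "v = differential A f p Y"
    using uv(1,2) by (auto simp: tangent_space_def)
  have "metric_inner G ?x X X = 1" "metric_inner G ?x Y Y = 1" "metric_inner G ?x X Y = 0"
    using uv(3-5) unfolding XY metric_inner_induced[OF x]
    by (simp_all add: differential_def norm_eq_1 orthogonal_def)
  then show ?thesis
    by (simp add: XY sff sectional_curvature_def sectional_curvature_coord_def coords gauss_equation[OF x])
qed

text \<open>The chosen bases are the same in the mutual curvature and in the two mean curvature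
  vectors, so bilinearity of the inner product collects the terms of the Gauss equation into one
  product of traces.\<close>

lemma mutual_curvature_gauss:
  assumes M: "immersed_submanifold M A f" "p \<in> topspace M"
    and P: "subspace (P p)" "P p \<subseteq> tangent_space A f p"
    and Q: "subspace (Q p)" "Q p \<subseteq> tangent_space A f p"
    and PQ: "\<And>u v. u \<in> P p \<Longrightarrow> v \<in> Q p \<Longrightarrow> orthogonal u v"
  shows "mutual_curvature A f P Q p = mean_curvature_vector A f P p \<bullet> mean_curvature_vector A f Q p
    - (\<Sum>u\<in>some_orthonormal_basis (P p). \<Sum>v\<in>some_orthonormal_basis (Q p).
        (norm (second_fundamental_form A f p u v))\<^sup>2)"
proof -
  have "mutual_curvature A f P Q p = (\<Sum>u\<in>some_orthonormal_basis (P p). \<Sum>v\<in>some_orthonormal_basis (Q p).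
      second_fundamental_form A f p u u \<bullet> second_fundamental_form A f p v v
      - (norm (second_fundamental_form A f p u v))\<^sup>2)"
    unfolding mutual_curvature_def
    by (intro sum.cong refl sectional_curvature_gauss[OF M])
      (use some_orthonormal_basis_unit[OF P(1)] some_orthonormal_basis_unit[OF Q(1)] P(2) Q(2) PQ in blast)+
  then show ?thesis
    unfolding mean_curvature_vector_def inner_sum_left by (simp add: sum_subtractf inner_sum_right)
qed

theorem corollary6:
  fixes M :: "'m topology"
    and A :: "((real^'n) set \<times> (real^'n \<Rightarrow> 'm)) set"
    and f :: "'m \<Rightarrow> complex^'q"
    and d l :: nat
  assumes "d > 0" and "l > 0"
    and "topspace M \<noteq> {}"
    and "CR_submanifold M A f d l"
    and "\<forall>p\<in>topspace M.
           mutual_curvature A f (holomorphic_distribution A f)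
             (tangent_complement A f (holomorphic_distribution A f)) p > 0"
  shows "\<not> distribution_minimal M A f (holomorphic_distribution A f)"
proof
  let ?D = "holomorphic_distribution A f"
  let ?E = "tangent_complement A f ?D"
  assume min: "distribution_minimal M A f ?D"
  \<comment> \<open>A single point suffices for the contradiction.\<close>
  obtain p where p: "p \<in> topspace M" using assms(3) by blast
  have M: "immersed_submanifold M A f"
    using assms(4) by (simp add: CR_submanifold_def)
  note T = subspace_tangent_space[OF M p]
  \<comment> \<open>Real linearity makes the image of the tangent space under the complex structure
    a subspace, and hence also the holomorphic distribution at \<open>p\<close>.\<close>
  have J: "linear (complex_structure :: complex^'q \<Rightarrow> complex^'q)"
    by (rule linearI) (simp_all add: complex_structure_def vec_eq_iff algebra_simps scaleR_conv_of_real)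
  have "mutual_curvature A f ?D ?E p = mean_curvature_vector A f ?D p \<bullet> mean_curvature_vector A f ?E p
    - (\<Sum>u\<in>some_orthonormal_basis (?D p). \<Sum>v\<in>some_orthonormal_basis (?E p).
        (norm (second_fundamental_form A f p u v))\<^sup>2)"
  proof (rule mutual_curvature_gauss[OF M p])
    show "subspace (?D p)"
      unfolding holomorphic_distribution_def
      by (intro subspace_inter linear_subspace_image J T)
    show "subspace (?E p)"
      unfolding tangent_complement_def by (intro subspace_inter subspace_orthogonal_comp T)
  qed (auto simp: holomorphic_distribution_def tangent_complement_def orthogonal_comp_def)
  \<comment> \<open>Minimality makes the first factor of the inner product zero, and what remains is
    minus a sum of squares.\<close>
  also have "\<dots> \<le> 0"
    using min p by (simp add: distribution_minimal_def sum_nonneg)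
  finally show False
    using assms(5) p by fastforce
qed

end
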